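(* Let $(B,S)$ be an equilibrium for a finite family of rollups, and let $i\ne j$ be two rollups that both post on the main market in it, i.e. $i,j\notin S$. Suppose rollups $i$ and $j$ join in posting blobs, and let $B^N$ be the blob price in an equilibrium after joining in which no rollup that posted blobs before stops posting blobs. Then $$2B\ \ge\ B^N\ \ge\ B.$$
   Context: Fixed parameters: $a,G,P_1>0$ and a target $k>0$ of blobs per time unit; metadata costs are zero ($P_0=0$). A rollup with transaction arrival rate $R>0$ posting a blob every $t$ time units at blob price $B$ has cost per transaction $\frac{B}{Rt}+\frac{at}{2}$, minimized at $t=\sqrt{2B/(aR)}$ with minimum $\sqrt{2Ba/R}$. Posting directly on the L1 main market instead has optimal cost per transaction $P_1G$. Each rollup uses the strategy with lower optimal cost per transaction (either one in case of a tie). An equilibrium for a finite family of rollups with rates $(R_l)_{l\in I}$, $R_l>0$, is a pair $(B,S)$ where $B>0$ is the blob price and $\emptyset\ne S\subseteq I$ is the set of blob-posting rollups, such that: (i) the blob target is met, $\sum_{l\in S}\sqrt{aR_l/(2B)}=k$, equivalently $B=\frac{a}{2k^2}\bigl(\sum_{l\in S}\sqrt{R_l}\bigr)^2$; (ii) $\sqrt{2Ba/R_l}\le P_1G$ for $l\in S$; (iii) $\sqrt{2Ba/R_l}\ge P_1G$ for $l\in I\setminus S$. When rollups $i$ and $j$ join in posting blobs, they are replaced in the family by a single joint rollup with arrival rate $R_i+R_j$. An equilibrium after joining is an equilibrium $(B^N,S^N)$ for the new family in which the joint rollup belongs to $S^N$ (it posts blobs). That no rollup stops posting blobs means $S\subseteq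 S^N$. *)

theory Defs
  imports Complex_Main
begin

definition blob_cost :: "real \<Rightarrow> real \<Rightarrow> real \<Rightarrow> real \<Rightarrow> real" where
  "blob_cost a B r t = B / (r * t) + a * t / 2"

definition blob_interval :: "real \<Rightarrow> real \<Rightarrow> real \<Rightarrow> real" where
  "blob_interval a B r = sqrt (2 * B / (a * r))"

definition opt_blob_cost :: "real \<Rightarrow> real \<Rightarrow> real \<Rightarrow> real" where
  "opt_blob_cost a B r = sqrt (2 * B * a / r)"

definition blob_rate :: "real \<Rightarrow> real \<Rightarrow> real \<Rightarrow> real" where
  "blob_rate a B r = sqrt (a * r / (2 * B))"

text \<open>The closed forms above are the minimiser of \<open>blob_cost\<close>, its minimum, and the number
  of blobs posted per time unit at the minimiser.\<close>

lemma blob_cost_interval: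
  assumes "a > 0" "B > 0" "r > 0"
  shows "blob_cost a B r (blob_interval a B r) = opt_blob_cost a B r"
proof -
  define t where "t = blob_interval a B r"
  have t: "t > 0" "t\<^sup>2 = 2 * B / (a * r)"
    using assms by (auto simp: t_def blob_interval_def)
  have B: "B = a * r * t\<^sup>2 / 2" using t assms by simp
  have "opt_blob_cost a B r = sqrt ((a * t)\<^sup>2)"
    unfolding opt_blob_cost_def
    by (rule arg_cong[where f = sqrt]) (use B assms in \<open>simp add: field_simps power2_eq_square\<close>)
  also have "\<dots> = a * t" using t assms by simp
  also have "\<dots> = blob_cost a B r t"
    unfolding blob_cost_def using t(1) assms
    by (subst B) (simp add: field_simps power2_eq_square)
  finally show ?thesis by (simp add: t_def)
qed

lemma opt_blob_cost_le:
  assumes "a > 0" "B > 0" "r > 0" "t > 0"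
  shows "opt_blob_cost a B r \<le> blob_cost a B r t"
  unfolding opt_blob_cost_def
proof (rule real_le_lsqrt)
  have "(blob_cost a B r t)\<^sup>2 - 2 * B * a / r = (B / (r * t) - a * t / 2)\<^sup>2"
    using assms by (simp add: blob_cost_def power2_eq_square field_simps)
  then show "2 * B * a / r \<le> (blob_cost a B r t)\<^sup>2"
    by (metis diff_ge_0_iff_ge zero_le_power2)
  show "0 \<le> blob_cost a B r t" using assms by (simp add: blob_cost_def)
qed

lemma blob_rate_eq: "blob_rate a B r = 1 / blob_interval a B r"
  by (simp add: blob_rate_def blob_interval_def real_sqrt_divide)

text \<open>\<open>a\<close> is the delay cost parameter, \<open>G\<close> and \<open>P1\<close> give the cost \<open>P1 * G\<close> per transaction on the
  main market, and \<open>k\<close> is the blob target; metadata costs are zero. \<open>I\<close> indexes the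
  rollups, with arrival rates \<open>R\<close>. Ties in the choice of strategy may be resolved either way.\<close>

definition equilibrium ::
  "real \<Rightarrow> real \<Rightarrow> real \<Rightarrow> real \<Rightarrow> 'i set \<Rightarrow> ('i \<Rightarrow> real) \<Rightarrow> real \<Rightarrow> 'i set \<Rightarrow> bool" where
  "equilibrium a G P1 k I R B S \<longleftrightarrow>
     B > 0 \<and> S \<noteq> {} \<and> S \<subseteq> I \<and>
     (\<Sum>l\<in>S. blob_rate a B (R l)) = k \<and>
     (\<forall>l\<in>S. opt_blob_cost a B (R l) \<le> P1 * G) \<and>
     (\<forall>l\<in>I - S. opt_blob_cost a B (R l) \<ge> P1 * G)"

lemma blob_target_iff_price:
  fixes R :: "'i \<Rightarrow> real"
  assumes "a > 0" "k > 0" "B > 0" "\<And>l. l \<in> S \<Longrightarrow> R l > 0"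
  shows "(\<Sum>l\<in>S. blob_rate a B (R l)) = k \<longleftrightarrow>
         B = a / (2 * k\<^sup>2) * (\<Sum>l\<in>S. sqrt (R l))\<^sup>2"
proof -
  define T where "T = (\<Sum>l\<in>S. sqrt (R l))"
  have T: "T \<ge> 0" unfolding T_def by (intro sum_nonneg) (use assms(4) in \<open>simp add: less_imp_le\<close>)
  have "blob_rate a B (R l) = sqrt (a / (2 * B)) * sqrt (R l)" for l
    by (simp add: blob_rate_def real_sqrt_mult[symmetric])
  then have "(\<Sum>l\<in>S. blob_rate a B (R l)) = sqrt (a / (2 * B)) * T"
    by (simp add: T_def sum_distrib_left)
  moreover have "sqrt (a / (2 * B)) * T = k \<longleftrightarrow> (sqrt (a / (2 * B)) * T)\<^sup>2 = k\<^sup>2"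
    using T assms by (intro power2_eq_iff_nonneg[symmetric]) auto
  moreover have "(sqrt (a / (2 * B)) * T)\<^sup>2 = a / (2 * B) * T\<^sup>2"
    using assms by (simp add: power_mult_distrib)
  moreover have "a / (2 * B) * T\<^sup>2 = k\<^sup>2 \<longleftrightarrow> B = a / (2 * k\<^sup>2) * T\<^sup>2"
    using assms by (auto simp: field_simps)
  ultimately show ?thesis by (simp add: T_def)
qed

text \<open>Rollups \<open>i\<close> and \<open>j\<close> are replaced by one joint rollup, labelled \<open>m\<close>. Any label not carried by
  a remaining rollup is allowed, i.e. \<open>m \<notin> I - {i, j}\<close>; in particular \<open>m\<close> may be fresh
  or one of \<open>i\<close>, \<open>j\<close>.\<close>

definition joined_index :: "'i set \<Rightarrow> 'i \<Rightarrow> 'i \<Rightarrow> 'i \<Rightarrow> 'i set" where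
  "joined_index I i j m = insert m (I - {i, j})"

definition joined_rates :: "('i \<Rightarrow> real) \<Rightarrow> 'i \<Rightarrow> 'i \<Rightarrow> 'i \<Rightarrow> 'i \<Rightarrow> real" where
  "joined_rates R i j m = R(m := R i + R j)"

definition equilibrium_after_joining ::
  "real \<Rightarrow> real \<Rightarrow> real \<Rightarrow> real \<Rightarrow> 'i set \<Rightarrow> ('i \<Rightarrow> real) \<Rightarrow> 'i \<Rightarrow> 'i \<Rightarrow> 'i \<Rightarrow> real \<Rightarrow> 'i set \<Rightarrow> bool"
  where
  "equilibrium_after_joining a G P1 k I R i j m BN SN \<longleftrightarrow>
     equilibrium a G P1 k (joined_index I i j m) (joined_rates R i j m) BN SN \<and> m \<in> SN"

end

theory Submission
  imports Defs
begin

text \<open>Let \<open>s\<close> be the sum of \<open>sqrt (R l)\<close> over the posting rollups. The price is proportional to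
  \<open>s\<^sup>2\<close>, and, up to ties, a rollup posts iff \<open>sqrt (R l) \<ge> \<theta> * s\<close>, where
  \<open>\<theta> = a / (k * P1 * G)\<close>. After joining, the sum \<open>s\<close> grows at least by
  \<open>x = sqrt (R i + R j)\<close>, so the threshold increases strictly and nobody except the joint
  rollup starts posting: the new sum is exactly \<open>s + x\<close>. Since \<open>i\<close> and \<open>j\<close> did not post,
  \<open>x \<le> sqrt 2 * \<theta> * s\<close>; since the joint rollup posts, \<open>\<theta> * (s + x) \<le> x\<close>. Eliminating
  \<open>\<theta>\<close> gives \<open>s + x \<le> sqrt 2 * s\<close>, hence the factor 2 for the prices.\<close>

text \<open>The market-clearing price carries the factor \<open>s\<^sup>2\<close>, so the root in
  the cost resolves and the cost becomes linear in \<open>s\<close>.\<close>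

lemma opt_blob_cost_at_target_price:
  assumes "a > 0" "k > 0" "r > 0" "s \<ge> 0"
  shows "opt_blob_cost a (a / (2 * k\<^sup>2) * s\<^sup>2) r = a * s / (k * sqrt r)"
proof -
  have "2 * (a / (2 * k\<^sup>2) * s\<^sup>2) * a / r = (a * s / k)\<^sup>2 / r"
    using assms by (simp add: field_simps power2_eq_square)
  then show ?thesis
    using assms by (simp add: opt_blob_cost_def real_sqrt_divide)
qed

text \<open>Turns both cost conditions into comparisons with one threshold. Since \<theta> depends
  only on the fixed parameters, it is the same before and after joining.\<close>

lemma equilibriumE:
  assumes "equilibrium a G P1 k I R B S"
    and "a > 0" "G > 0" "P1 > 0" "k > 0" "\<forall>l\<in>I. R l > 0"
  obtains \<theta> s where "\<theta> = a / (k * P1 * G)" "s = (\<Sum>l\<in>S. sqrt (R l))" "B = a / (2 * k\<^sup>2) * s\<^sup>2"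
    "\<And>l. l \<in> S \<Longrightarrow> \<theta> * s \<le> sqrt (R l)" "\<And>l. l \<in> I - S \<Longrightarrow> sqrt (R l) \<le> \<theta> * s"
proof -
  define s where "s = (\<Sum>l\<in>S. sqrt (R l))"
  have S: "S \<subseteq> I" "B > 0" "(\<Sum>l\<in>S. blob_rate a B (R l)) = k"
    using assms(1) by (auto simp: equilibrium_def)
  have pos: "R l > 0" if "l \<in> S" for l using that S(1) assms(6) by auto
  have s: "s \<ge> 0" unfolding s_def by (intro sum_nonneg) (use pos in \<open>simp add: less_imp_le\<close>)
  have B: "B = a / (2 * k\<^sup>2) * s\<^sup>2"
    using blob_target_iff_price[of a k B S R] S pos assms(2,5) by (simp add: s_def)
  have cost: "opt_blob_cost a B (R l) = a * s / (k * sqrt (R l))" if "l \<in> I" for l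
    using opt_blob_cost_at_target_price assms(2,5,6) s that by (simp add: B)
  show thesis
  proof (rule that[OF refl s_def B])
    fix l assume l: "l \<in> S"
    then have "a * s / (k * sqrt (R l)) \<le> P1 * G"
      using assms(1) S(1) cost[of l] unfolding equilibrium_def by (metis subsetD)
    then show "a / (k * P1 * G) * s \<le> sqrt (R l)"
      using pos[OF l] assms(2-5) by (simp add: field_simps)
  next
    fix l assume l: "l \<in> I - S"
    then have "a * s / (k * sqrt (R l)) \<ge> P1 * G"
      using assms(1) cost by (auto simp: equilibrium_def)
    moreover have "R l > 0" using l assms(6) by auto
    ultimately show "sqrt (R l) \<le> a / (k * P1 * G) * s"
      using assms(2-5) by (simp add: field_simps)
  qed
qed

theorem proposition4:
  fixes a G P1 k B BN :: real
    and I S SN :: "'i set" and R :: "'i \<Rightarrow> real" and i j m :: 'i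
  assumes "a > 0" and "G > 0" and "P1 > 0" and "k > 0"
    and "finite I" and "\<forall>l\<in>I. R l > 0"
    and "equilibrium a G P1 k I R B S"
    and "i \<in> I - S" and "j \<in> I - S" and "i \<noteq> j"
    and "m \<notin> I - {i, j}"
    and "equilibrium_after_joining a G P1 k I R i j m BN SN"
    and "S \<subseteq> SN"
  shows "2 * B \<ge> BN \<and> BN \<ge> B"
proof -
  define J where "J = joined_index I i j m"
  define Q where "Q = joined_rates R i j m"
  define x where "x = sqrt (R i + R j)"
  have eqN: "equilibrium a G P1 k J Q BN SN" and m: "m \<in> SN"
    using assms(12) by (auto simp: equilibrium_after_joining_def J_def Q_def)
  have SI: "S \<subseteq> I" "S \<noteq> {}" using assms(7) by (auto simp: equilibrium_def)
  have SNJ: "SN \<subseteq> J" using eqN by (auto simp: equilibrium_def)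
  \<comment> \<open>Whether \<open>m\<close> is fresh or one of \<open>i\<close>, \<open>j\<close>,
    it lies outside \<open>S\<close>, so \<open>Q\<close> and \<open>R\<close> agree on
    \<open>S\<close>.\<close>
  have mS: "m \<notin> S" using assms(8,9,11) SI by auto
  have Rij: "R i > 0" "R j > 0" using assms(6,8,9) by auto
  have Qm: "Q m = R i + R j" and QR: "\<And>l. l \<noteq> m \<Longrightarrow> Q l = R l"
    by (auto simp: Q_def joined_rates_def)
  have Qpos: "\<forall>l\<in>J. Q l > 0"
    using assms(6) Rij by (auto simp: Q_def J_def joined_index_def joined_rates_def)
  have finN: "finite SN" using SNJ assms(5) finite_subset by (fastforce simp: J_def joined_index_def)
  then have finS: "finite S" using assms(13) finite_subset by blast
  obtain \<theta> s where \<theta>: "\<theta> = a / (k * P1 * G)" and s: "s = (\<Sum>l\<in>S. sqrt (R l))"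
    and B: "B = a / (2 * k\<^sup>2) * s\<^sup>2" and out: "\<And>l. l \<in> I - S \<Longrightarrow> sqrt (R l) \<le> \<theta> * s"
    using equilibriumE[OF assms(7,1-4,6)] by metis
  obtain sN where sN: "sN = (\<Sum>l\<in>SN. sqrt (Q l))"
    and BN: "BN = a / (2 * k\<^sup>2) * sN\<^sup>2" and inN: "\<And>l. l \<in> SN \<Longrightarrow> \<theta> * sN \<le> sqrt (Q l)"
    using equilibriumE[OF eqN assms(1-4) Qpos] \<theta> by metis
  have \<theta>0: "\<theta> > 0" using assms(1-4) \<theta> by simp
  have x0: "x > 0" using Rij by (simp add: x_def)
  have s0: "s > 0" unfolding s using finS SI assms(6) by (intro sum_pos) auto
  have sum_join: "(\<Sum>l\<in>insert m S. sqrt (Q l)) = s + x"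
  proof -
    have "(\<Sum>l\<in>S. sqrt (Q l)) = s"
      unfolding s using mS QR by (intro sum.cong refl) metis
    then show ?thesis using finS mS by (simp add: Qm x_def)
  qed
  \<comment> \<open>Here it enters that no rollup stops posting: \<open>insert m S\<close> is
    contained in \<open>SN\<close>, and all terms are nonnegative.\<close>
  have sN_ge: "s + x \<le> sN"
    unfolding sN sum_join[symmetric] using finN m assms(13) SNJ Qpos
    by (intro sum_mono2) (auto intro: less_imp_le)
  have "SN \<subseteq> insert m S"
  proof
    fix l assume l: "l \<in> SN"
    show "l \<in> insert m S"
    proof (rule ccontr)
      assume "l \<notin> insert m S"
      \<comment> \<open>Such an \<open>l\<close> is an old rollup with unchanged rate: it stayed out
        at threshold \<open>\<theta> * s\<close>, yet posts at the strictly larger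
        \<open>\<theta> * sN\<close>.\<close>
      then have "l \<in> I - S" "Q l = R l"
        using l SNJ QR by (auto simp: J_def joined_index_def)
      then have "\<theta> * sN \<le> \<theta> * s" using inN[OF l] out[of l] by simp
      then show False using \<theta>0 sN_ge x0 by simp
    qed
  qed
  then have "SN = insert m S" using m assms(13) by auto
  then have sN_eq: "sN = s + x" using sN sum_join by simp
  have x_ge: "\<theta> * (s + x) \<le> x" using inN[OF m] sN_eq by (simp add: Qm x_def)
  have x_le: "x \<le> sqrt 2 * \<theta> * s"
  proof -
    \<comment> \<open>Rates, not their roots, add up under joining, so the bounds for
      \<open>i\<close> and \<open>j\<close> are squared before being summed; this yields
      \<open>sqrt 2\<close> rather than 2.\<close>
    have "R l \<le> (\<theta> * s)\<^sup>2" if "l \<in> I - S" for l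
      using out[OF that] by (rule sqrt_le_D)
    from this[OF assms(8)] this[OF assms(9)] have "x \<le> sqrt (2 * (\<theta> * s)\<^sup>2)"
      unfolding x_def by (intro real_sqrt_le_mono) simp
    then show ?thesis using \<theta>0 s0 by (simp add: real_sqrt_mult)
  qed
  have "\<theta> * (s + x) \<le> \<theta> * (sqrt 2 * s)" using x_ge x_le by (simp add: mult_ac)
  then have "sN \<le> sqrt 2 * s" using \<theta>0 sN_eq by simp
  then have "sN\<^sup>2 \<le> (sqrt 2 * s)\<^sup>2" using sN_eq s0 x0 by (intro power_mono) auto
  then have upper: "sN\<^sup>2 \<le> 2 * s\<^sup>2" by (simp add: power_mult_distrib)
  have lower: "s\<^sup>2 \<le> sN\<^sup>2" using sN_eq s0 x0 by (intro power_mono) auto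
  have c: "0 \<le> a / (2 * k\<^sup>2)" using assms(1) by simp
  show ?thesis
    using mult_left_mono[OF upper c] mult_left_mono[OF lower c] unfolding B BN by simp
qed

end
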